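(* Let $\Omega=\{1,2,3\}$ carry the uniform probability measure $\mu$ (on the power set of $\Omega$), let $p=\tfrac12$, and let $W\colon\Omega^2\to[0,1]$ be the symmetric kernel whose values $W(i,j)$ are the entries of the matrix $$W=\begin{pmatrix}1&0&0\\0&1&\tfrac34\\0&\tfrac34&1\end{pmatrix}.$$ Then $$\iint_{U\times U}W(x,y)\,\mathrm d\mu(x)\,\mathrm d\mu(y)\geq p\,\mu(U)^2\qquad\text{for every }U\subseteq\Omega,$$ but for the function $f\colon\Omega\to[0,1]$ with $(f(1),f(2),f(3))=(1,\tfrac23,\tfrac23)$ the inequality $$\iint_{\Omega^2}f(x)W(x,y)f(y)\,\mathrm d\mu(x)\,\mathrm d\mu(y)\geq p\,\lVert f\rVert_1^{2}$$ fails.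
   Context: $\lVert f\rVert_1=\int_\Omega|f|\,\mathrm d\mu$. *)

theory Defs
  imports "HOL-Probability.Probability"
begin

text \<open>The points of \<open>\<Omega>\<close> live in the three-element type \<^typ>\<open>3\<close>, whose elements are
  \<open>1\<close>, \<open>2\<close> and \<open>3\<close> (the last one also being written \<open>0\<close>), so that they index the literals
  below in the usual way.\<close>

definition Omega :: "3 set" where
  "Omega = {1, 2, 3}"

lemma Omega_eq_UNIV: "Omega = UNIV" and card_Omega: "card Omega = 3"
  by (simp_all add: Omega_def UNIV_3 [symmetric])

definition mu :: "3 measure" where
  "mu = uniform_count_measure Omega"

lemma space_mu: "space mu = Omega" and sets_mu: "sets mu = Pow Omega"
  by (simp_all add: mu_def space_uniform_count_measure sets_uniform_count_measure)

lemma prob_space_mu: "prob_space mu"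
  unfolding mu_def by (rule prob_space_uniform_count_measure) (simp_all add: Omega_def)

definition W :: "3 \<Rightarrow> 3 \<Rightarrow> real" where
  "W i j = (vector [vector [1, 0,   0  ],
                    vector [0, 1,   3/4],
                    vector [0, 3/4, 1  ]] :: real^3^3) $ i $ j"

lemma W_symmetric: "W x y = W y x"
  using exhaust_3 [of x] exhaust_3 [of y] by (auto simp: W_def)

lemma W_range: "W x y \<in> {0..1}"
  using exhaust_3 [of x] exhaust_3 [of y] by (auto simp: W_def)

definition f :: "3 \<Rightarrow> real" where
  "f i = (vector [1, 2/3, 2/3] :: real^3) $ i"

lemma f_range: "f x \<in> {0..1}"
  using exhaust_3 [of x] by (auto simp: f_def)

definition L1_norm :: "(3 \<Rightarrow> real) \<Rightarrow> real" where
  "L1_norm g = (LINT x:Omega|mu. \<bar>g x\<bar>)"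

end

theory Submission
  imports Defs
begin

text \<open>
  For a function \<open>g\<close> with values \<open>a, b, c\<close> at \<open>1, 2, 3\<close>, the quadratic form of \<open>W\<close> exceeds half the
  square of the mean of \<open>g\<close> by \<open>q / 18\<close>, where \<open>q = a\<^sup>2 + b\<^sup>2 + c\<^sup>2 + b c - 2 a (b + c)\<close>
  (lemma \<open>W_quadratic_form_excess\<close>). Both halves of the theorem are statements about the sign
  of \<open>q\<close>.

  On indicator functions \<open>q\<close> is nonnegative: for \<open>a = 0\<close> all its terms are, and for \<open>a = 1\<close> and
  \<open>b, c \<in> {0, 1}\<close> it equals \<open>(1 - b) (1 - c)\<close>. There is no slack:
  equality holds for \<open>U = {1, 2}\<close>, \<open>{1, 3}\<close> and
  the whole space. Between \<open>0\<close> and \<open>1\<close> the relation \<open>b\<^sup>2 = b\<close> is lost: along \<open>a = 1\<close>, \<open>b = c = t\<close>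
  the form is \<open>(3 t - 1) (t - 1)\<close>, which is negative for \<open>1/3 < t < 1\<close> and least at \<open>t = 2/3\<close>.
  The function \<open>f\<close> is this minimiser; there \<open>q = - 1/3\<close>.
\<close>

lemma finite_measure_uniform_count_measure:
  "finite A \<Longrightarrow> finite_measure (uniform_count_measure A)"
  by (rule finite_measureI)
     (simp add: space_uniform_count_measure emeasure_uniform_count_measure)

text \<open>
  This turns a double integral over a finite uniform space into one finite sum, with no
  integrability conditions to check. Measurable rectangles have matching measures because
  cardinality is multiplicative, and they determine a product of \<open>\<sigma>\<close>-finite measures.
\<close>

lemma pair_uniform_count_measure:
  assumes "finite A" "finite B"
  shows "uniform_count_measure A \<Otimes>\<^sub>M uniform_count_measure B = uniform_count_measure (A \<times> B)"
proof (rule pair_measure_eqI)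
  show "sigma_finite_measure (uniform_count_measure A)" "sigma_finite_measure (uniform_count_measure B)"
    using assms by (simp_all add: finite_measure.sigma_finite_measure finite_measure_uniform_count_measure)
  have "sets (uniform_count_measure A \<Otimes>\<^sub>M uniform_count_measure B)
      = sets (count_space A \<Otimes>\<^sub>M count_space B)"
    by (intro sets_pair_measure_cong) (rule sets_uniform_count_measure_count_space)+
  also have "count_space A \<Otimes>\<^sub>M count_space B = count_space (A \<times> B)"
    using assms by (intro pair_measure_countable countable_finite)
  finally show "sets (uniform_count_measure A \<Otimes>\<^sub>M uniform_count_measure B)
      = sets (uniform_count_measure (A \<times> B))"
    by (simp add: sets_uniform_count_measure)
next
  fix X Y
  assume "X \<in> sets (uniform_count_measure A)" "Y \<in> sets (uniform_count_measure B)"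
  then have "X \<subseteq> A" "Y \<subseteq> B"
    by (simp_all add: sets_uniform_count_measure)
  moreover from this have "X \<times> Y \<subseteq> A \<times> B"
    by auto
  ultimately show "emeasure (uniform_count_measure A) X * emeasure (uniform_count_measure B) Y
      = emeasure (uniform_count_measure (A \<times> B)) (X \<times> Y)"
    using assms by (simp add: emeasure_uniform_count_measure ennreal_mult' [symmetric]
        card_cartesian_product)
qed

lemma integral_mu: "(LINT x|mu. g x) = (g 1 + g 2 + g 3) / 3" for g :: "3 \<Rightarrow> real"
  unfolding mu_def Omega_eq_UNIV by (simp add: integral_uniform_count_measure sum_3)

lemma integral_mu_pair:
  fixes h :: "3 \<times> 3 \<Rightarrow> real"
  shows "(LINT z|(mu \<Otimes>\<^sub>M mu). h z) = (\<Sum>x\<in>UNIV. \<Sum>y\<in>UNIV. h (x, y)) / 9"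
proof -
  have "mu \<Otimes>\<^sub>M mu = uniform_count_measure (UNIV \<times> UNIV)"
    unfolding mu_def Omega_eq_UNIV by (rule pair_uniform_count_measure) simp_all
  then show ?thesis
    by (simp add: integral_uniform_count_measure sum.cartesian_product
        flip: UNIV_Times_UNIV)
qed

text \<open>
  Writing \<open>a, b, c\<close> for the values of \<open>g\<close>, the integral contributes \<open>2 (a\<^sup>2 + b\<^sup>2 + c\<^sup>2) + 3 b c\<close> over the common
  denominator \<open>18\<close>, and the squared mean removes \<open>(a + b + c)\<^sup>2\<close>.
\<close>

lemma W_quadratic_form_excess:
  fixes g :: "3 \<Rightarrow> real"
  shows "(LINT z|(mu \<Otimes>\<^sub>M mu). g (fst z) * W (fst z) (snd z) * g (snd z)) - ((g 1 + g 2 + g 3) / 3)\<^sup>2 / 2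
    = ((g 1)\<^sup>2 + (g 2)\<^sup>2 + (g 3)\<^sup>2 + g 2 * g 3 - 2 * g 1 * (g 2 + g 3)) / 18"
  unfolding integral_mu_pair by (simp add: sum_3 W_def field_simps power2_eq_square)

theorem proposition8:
  fixes p :: real
  assumes "p = 1/2"
  shows "(\<forall>U. U \<subseteq> Omega \<longrightarrow>
           (LINT z:U \<times> U|mu \<Otimes>\<^sub>M mu. W (fst z) (snd z)) \<ge> p * (measure mu U)\<^sup>2) \<and>
         \<not> ((LINT z:Omega \<times> Omega|mu \<Otimes>\<^sub>M mu. f (fst z) * W (fst z) (snd z) * f (snd z))
             \<ge> p * (L1_norm f)\<^sup>2)"
proof (intro conjI allI impI)
  fix U assume U: "U \<subseteq> Omega"
  define u :: "3 \<Rightarrow> real" where "u = indicator U"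
  have "u x = 0 \<or> u x = 1" for x
    by (auto simp: u_def indicator_def)
  from this[of 1] this[of 2] this[of 3]
  have "0 \<le> (u 1)\<^sup>2 + (u 2)\<^sup>2 + (u 3)\<^sup>2 + u 2 * u 3 - 2 * u 1 * (u 2 + u 3)"
    by (elim disjE) simp_all
  then have "0 \<le> (LINT z|(mu \<Otimes>\<^sub>M mu). u (fst z) * W (fst z) (snd z) * u (snd z))
      - ((u 1 + u 2 + u 3) / 3)\<^sup>2 / 2"
    unfolding W_quadratic_form_excess by (rule divide_nonneg_pos) simp
  moreover have "measure mu U = (u 1 + u 2 + u 3) / 3"
  proof -
    have "U \<in> sets mu"
      using U by (simp add: sets_mu)
    then have "measure mu U = (LINT x|mu. u x)"
      by (simp add: u_def sets_mu space_mu U Int_absorb1 Int_absorb2)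
    then show ?thesis
      by (simp add: integral_mu)
  qed
  moreover have "(LINT z:U \<times> U|mu \<Otimes>\<^sub>M mu. W (fst z) (snd z))
      = (LINT z|(mu \<Otimes>\<^sub>M mu). u (fst z) * W (fst z) (snd z) * u (snd z))"
    unfolding set_lebesgue_integral_def u_def
    by (intro Bochner_Integration.integral_cong) (auto simp: indicator_def)
  ultimately show "p * (measure mu U)\<^sup>2 \<le> (LINT z:U \<times> U|mu \<Otimes>\<^sub>M mu. W (fst z) (snd z))"
    using assms by (simp only: times_divide_eq_left mult_1_left diff_ge_0_iff_ge)
next
  have f: "f 1 = 1" "f 2 = 2/3" "f 3 = 2/3"
    by (simp_all add: f_def)
  have "L1_norm f = (f 1 + f 2 + f 3) / 3"
    unfolding L1_norm_def set_lebesgue_integral_def by (simp add: Omega_eq_UNIV integral_mu f)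
  moreover have "(LINT z|(mu \<Otimes>\<^sub>M mu). f (fst z) * W (fst z) (snd z) * f (snd z))
      - ((f 1 + f 2 + f 3) / 3)\<^sup>2 / 2 < 0"
    unfolding W_quadratic_form_excess by (simp add: f power2_eq_square)
  moreover have "(LINT z:Omega \<times> Omega|mu \<Otimes>\<^sub>M mu. f (fst z) * W (fst z) (snd z) * f (snd z))
      = (LINT z|(mu \<Otimes>\<^sub>M mu). f (fst z) * W (fst z) (snd z) * f (snd z))"
    by (simp add: set_lebesgue_integral_def Omega_eq_UNIV)
  ultimately show "\<not> p * (L1_norm f)\<^sup>2
      \<le> (LINT z:Omega \<times> Omega|mu \<Otimes>\<^sub>M mu. f (fst z) * W (fst z) (snd z) * f (snd z))"
    using assms by (simp only: times_divide_eq_left mult_1_left diff_less_0_iff_less not_le)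
qed

end
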